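(* Let $\Gamma$ be a countable group of Borel automorphisms of a standard Borel space $(X,\mathcal B)$ which acts freely and is orbit equivalent to the 2-odometer. Let $G$ be a locally compact second countable abelian group, let $\alpha:\Gamma\times X\to G$ be a cocycle of $\Gamma$ with values in $G$, and let $H$ be a dense countable subgroup of $G$. Then $\alpha$ is cohomologous to a cocycle $\beta$ with values in the subgroup $H$.
   Context: A Borel automorphism is a Borel bijection of $X$ onto itself. $\Gamma$ acts freely if $\gamma x\ne x$ for all $x\in X$ and all non-identity $\gamma\in\Gamma$. The 2-odometer is the map $S$ on $\Omega=\prod_{n\ge0}\{0,1\}$ defined by $S(1,1,1,\dots)=(0,0,0,\dots)$ and, for any other $x$, with $k$ the least index such that $x_k\ne1$, $S(x)=(0,\dots,0,x_k+1,x_{k+1},x_{k+2},\dots)$ where the entry $x_k+1$ is in position $k$ and all later entries of $x$ (from position $k+1$ on) are unchanged. Countable groups $\Gamma_i\subset Aut(X_i,\mathcal B_i)$, $i=1,2$, are orbit equivalent if there is a Borel isomorphism $\varphi:X_1\to X_2$ with $\varphi(\Gamma_1x)=\Gamma_2\varphi(x)$ for all $x\in X_1$; here $\Gamma$ is orbit equivalent to the group $\{S^n:n\in\mathbb Z\}$. $G$ is written additively. A cocycle of $\Gamma$ is a Borel function $a:\Gamma\times X\to G$ ($\Gamma$ discrete) with $a(\gamma_1\gamma_2,x)=a(\gamma_1,\gamma_2x)+a(\gamma_2,x)$ for all $\gamma_1,\gamma_2,x$ and $a(\mathbb 1,x)=0$, where $\mathbb 1$ is the identity map. Cocycles $a_1,a_2:\Gamma\times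 X\to G$ are cohomologous if there is a Borel function $c:X\to G$ with $a_1(\gamma,x)=c(\gamma x)+a_2(\gamma,x)-c(x)$ for all $\gamma\in\Gamma$, $x\in X$. *)

theory Defs
  imports "HOL-Analysis.Analysis" "HOL-Algebra.Bij"
begin

text \<open>Measure spaces serve only as measurable spaces (carrier and \<open>\<sigma>\<close>-algebra); the
  measure they carry plays no role.\<close>

definition standard_borel :: "'a measure \<Rightarrow> bool" where
  "standard_borel M \<longleftrightarrow>
     (\<exists>T. topspace T = space M \<and> completely_metrizable_space T \<and> separable_space T \<and>
          sets M = sigma_sets (space M) {U. openin T U})"

text \<open>Automorphisms are extensional functions on \<open>space M\<close>, so that they form a subset of
  the permutation group \<open>BijGroup (space M)\<close>, with composition as multiplication. Measurability
  of the inverse is not demanded.\<close>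

definition borel_automorphisms :: "'a measure \<Rightarrow> ('a \<Rightarrow> 'a) set" where
  "borel_automorphisms M = Bij (space M) \<inter> measurable M M"

definition countable_borel_group :: "'a measure \<Rightarrow> ('a \<Rightarrow> 'a) set \<Rightarrow> bool" where
  "countable_borel_group M \<Gamma> \<longleftrightarrow>
     subgroup \<Gamma> (BijGroup (space M)) \<and> \<Gamma> \<subseteq> borel_automorphisms M \<and> countable \<Gamma>"

definition acts_freely :: "'a measure \<Rightarrow> ('a \<Rightarrow> 'a) set \<Rightarrow> bool" where
  "acts_freely M \<Gamma> \<longleftrightarrow>
     (\<forall>\<gamma>\<in>\<Gamma>. \<gamma> \<noteq> \<one>\<^bsub>BijGroup (space M)\<^esub> \<longrightarrow> (\<forall>x\<in>space M. \<gamma> x \<noteq> x))"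

definition group_orbit :: "('a \<Rightarrow> 'a) set \<Rightarrow> 'a \<Rightarrow> 'a set" where
  "group_orbit \<Gamma> x = (\<lambda>\<gamma>. \<gamma> x) ` \<Gamma>"

definition borel_isomorphism :: "'a measure \<Rightarrow> 'b measure \<Rightarrow> ('a \<Rightarrow> 'b) \<Rightarrow> bool" where
  "borel_isomorphism M N \<phi> \<longleftrightarrow>
     bij_betw \<phi> (space M) (space N) \<and> \<phi> \<in> measurable M N \<and>
     inv_into (space M) \<phi> \<in> measurable N M"

definition orbit_equivalent ::
  "'a measure \<Rightarrow> ('a \<Rightarrow> 'a) set \<Rightarrow> 'b measure \<Rightarrow> ('b \<Rightarrow> 'b) set \<Rightarrow> bool" where
  "orbit_equivalent M \<Gamma> N \<Delta> \<longleftrightarrow>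
     (\<exists>\<phi>. borel_isomorphism M N \<phi> \<and>
        (\<forall>x\<in>space M. \<phi> ` group_orbit \<Gamma> x = group_orbit \<Delta> (\<phi> x)))"

definition odometer_space :: "(nat \<Rightarrow> nat) measure" where
  "odometer_space = (\<Pi>\<^sub>M n\<in>UNIV. count_space {0, 1})"

definition odometer :: "(nat \<Rightarrow> nat) \<Rightarrow> (nat \<Rightarrow> nat)" where
  "odometer = (\<lambda>x\<in>space odometer_space.
     if \<forall>i. x i = 1 then (\<lambda>i. 0)
     else (let k = LEAST i. x i \<noteq> 1
           in (\<lambda>i. if i < k then 0 else if i = k then x k + 1 else x i)))"

definition odometer_group :: "((nat \<Rightarrow> nat) \<Rightarrow> (nat \<Rightarrow> nat)) set" where
  "odometer_group = range (\<lambda>n::int. odometer [^]\<^bsub>BijGroup (space odometer_space)\<^esub> n)"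

text \<open>The powers above are meaningful because the odometer lies in the permutation group.\<close>

lemma space_odometer_space: "x \<in> space odometer_space \<longleftrightarrow> (\<forall>i. x i = 0 \<or> x i = 1)"
  by (auto simp: odometer_space_def space_PiM PiE_def Pi_def)

lemma odometer_in_Bij: "odometer \<in> Bij (space odometer_space)"
proof -
  define T :: "(nat \<Rightarrow> nat) \<Rightarrow> (nat \<Rightarrow> nat)" where
    "T y = (if \<forall>i. y i = 0 then (\<lambda>i. 1)
       else (let k = LEAST i. y i \<noteq> 0
             in (\<lambda>i. if i < k then 1 else if i = k then 0 else y i)))" for y
  let ?\<Omega> = "space odometer_space"
  have S: "odometer x \<in> ?\<Omega> \<and> T (odometer x) = x" if x: "x \<in> ?\<Omega>" for x
  proof (cases "\<forall>i. x i = 1")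
    case True
    then show ?thesis
      using x by (auto simp: odometer_def T_def space_odometer_space)
  next
    case False
    define k where "k = (LEAST i. x i \<noteq> 1)"
    have below: "x i = 1" if "i < k" for i
      using not_less_Least[OF that[unfolded k_def]] by simp
    have "x k \<noteq> 1"
      unfolding k_def by (rule LeastI_ex) (use False in simp)
    then have xk: "x k = 0"
      using x unfolding space_odometer_space by metis
    have o: "odometer x = (\<lambda>i. if i < k then 0 else if i = k then 1 else x i)"
      by (simp only: odometer_def restrict_apply x xk False if_True if_False Let_def
          k_def[symmetric] add_0_left)
    have l: "(LEAST i. odometer x i \<noteq> 0) = k"
      by (rule Least_equality) (auto simp: o not_less[symmetric])
    have n: "\<not> (\<forall>i. odometer x i = 0)"
      by (auto simp: o intro!: exI[of _ k])
    have "T (odometer x) = (\<lambda>i. if i < k then 1 else if i = k then 0 else odometer x i)"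
      by (simp only: T_def n if_False l Let_def)
    also have "\<dots> = x"
      using below xk by (auto simp: o)
    finally have "T (odometer x) = x" .
    then show ?thesis
      using x by (auto simp: o space_odometer_space)
  qed
  have T: "T y \<in> ?\<Omega> \<and> odometer (T y) = y" if y: "y \<in> ?\<Omega>" for y
  proof (cases "\<forall>i. y i = 0")
    case True
    then show ?thesis
      using y by (auto simp: odometer_def T_def space_odometer_space)
  next
    case False
    define k where "k = (LEAST i. y i \<noteq> 0)"
    have below: "y i = 0" if "i < k" for i
      using not_less_Least[OF that[unfolded k_def]] by simp
    have "y k \<noteq> 0"
      unfolding k_def by (rule LeastI_ex) (use False in simp)
    then have yk: "y k = 1"
      using y unfolding space_odometer_space by metis
    have t: "T y = (\<lambda>i. if i < k then 1 else if i = k then 0 else y i)"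
      by (simp only: T_def if_False False Let_def k_def[symmetric])
    have l: "(LEAST i. T y i \<noteq> 1) = k"
      by (rule Least_equality) (auto simp: t not_less[symmetric])
    have n: "\<not> (\<forall>i. T y i = 1)"
      by (auto simp: t intro!: exI[of _ k])
    have c: "T y \<in> ?\<Omega>"
      using y by (auto simp: t space_odometer_space)
    have "odometer (T y) = (\<lambda>i. if i < k then 0 else if i = k then T y k + 1 else T y i)"
      by (simp only: odometer_def restrict_apply c n if_True if_False l Let_def)
    also have "\<dots> = y"
      using below yk by (auto simp: t)
    finally show ?thesis
      using c by blast
  qed
  have "bij_betw odometer ?\<Omega> ?\<Omega>"
    by (rule bij_betw_byWitness[where f' = T]) (use S T in auto)
  then show ?thesis
    by (simp add: Bij_def odometer_def)
qed

definition cocycle ::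
  "'a measure \<Rightarrow> ('a \<Rightarrow> 'a) set \<Rightarrow> (('a \<Rightarrow> 'a) \<Rightarrow> 'a \<Rightarrow> 'g::topological_ab_group_add) \<Rightarrow> bool" where
  "cocycle M \<Gamma> a \<longleftrightarrow>
     (\<lambda>(\<gamma>, x). a \<gamma> x) \<in> borel_measurable (count_space \<Gamma> \<Otimes>\<^sub>M M) \<and>
     (\<forall>\<gamma>\<^sub>1\<in>\<Gamma>. \<forall>\<gamma>\<^sub>2\<in>\<Gamma>. \<forall>x\<in>space M.
        a (\<gamma>\<^sub>1 \<otimes>\<^bsub>BijGroup (space M)\<^esub> \<gamma>\<^sub>2) x = a \<gamma>\<^sub>1 (\<gamma>\<^sub>2 x) + a \<gamma>\<^sub>2 x) \<and>
     (\<forall>x\<in>space M. a \<one>\<^bsub>BijGroup (space M)\<^esub> x = 0)"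

definition cohomologous ::
  "'a measure \<Rightarrow> ('a \<Rightarrow> 'a) set \<Rightarrow> (('a \<Rightarrow> 'a) \<Rightarrow> 'a \<Rightarrow> 'g::topological_ab_group_add) \<Rightarrow>
   (('a \<Rightarrow> 'a) \<Rightarrow> 'a \<Rightarrow> 'g) \<Rightarrow> bool" where
  "cohomologous M \<Gamma> a\<^sub>1 a\<^sub>2 \<longleftrightarrow>
     (\<exists>c \<in> borel_measurable M. \<forall>\<gamma>\<in>\<Gamma>. \<forall>x\<in>space M. a\<^sub>1 \<gamma> x = c (\<gamma> x) + a\<^sub>2 \<gamma> x - c x)"

definition subgroup_add :: "'g::ab_group_add set \<Rightarrow> bool" where
  "subgroup_add H \<longleftrightarrow> 0 \<in> H \<and> (\<forall>a\<in>H. \<forall>b\<in>H. a + b \<in> H) \<and> (\<forall>a\<in>H. - a \<in> H)"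

end

theory Submission
  imports Defs "HOL-Algebra.Generated_Groups"
begin

text \<open>The odometer relation is hyperfinite: up to the orbit of the eventually constant sequences, two
  points are equivalent iff deleting a long enough initial segment identifies them. Let \<open>\<tau>\<^sub>n\<close> overwrite
  the first \<open>n\<close> digits by zeros, transported to the given space. The value of the cocycle from \<open>x\<close>
  to \<open>\<tau>\<^sub>n x\<close> is the sum over \<open>i < n\<close> of its increments \<open>E\<^sub>i (\<tau>\<^sub>i x)\<close>. Let \<open>q\<^sub>i\<close> be a Borel map
  into the dense subgroup that is uniformly close to the identity, with rapidly decreasing error. Then
  \<open>c x = (\<Sum>i. q\<^sub>i (E\<^sub>i (\<tau>\<^sub>i x)) - E\<^sub>i (\<tau>\<^sub>i x))\<close> converges uniformly. If \<open>\<tau>\<^sub>n x = \<tau>\<^sub>n y\<close>, all terms with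
  \<open>i \<ge> n\<close> agree for \<open>x\<close> and \<open>y\<close>, so that subtracting the coboundary of \<open>c\<close> leaves a finite sum of
  values of the \<open>q\<^sub>i\<close>.\<close>

section \<open>Orbits of permutation groups\<close>

lemma BijGroup_mult_apply:
  "g \<in> Bij S \<Longrightarrow> h \<in> Bij S \<Longrightarrow> x \<in> S \<Longrightarrow> (g \<otimes>\<^bsub>BijGroup S\<^esub> h) x = g (h x)"
  by (simp add: BijGroup_def compose_def)

lemma BijGroup_one_apply: "x \<in> S \<Longrightarrow> \<one>\<^bsub>BijGroup S\<^esub> x = x"
  by (simp add: BijGroup_def)

lemma carrier_BijGroup: "carrier (BijGroup S) = Bij S"
  by (simp add: BijGroup_def)

lemma Bij_apply_mem: "g \<in> Bij S \<Longrightarrow> x \<in> S \<Longrightarrow> g x \<in> S"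
  using Bij_imp_funcset by blast

lemma BijGroup_inv_apply:
  assumes "g \<in> Bij S" "x \<in> S"
  shows "(inv\<^bsub>BijGroup S\<^esub> g) (g x) = x" "g ((inv\<^bsub>BijGroup S\<^esub> g) x) = x"
proof -
  interpret group "BijGroup S" by (rule group_BijGroup)
  have i: "inv\<^bsub>BijGroup S\<^esub> g \<in> Bij S"
    using inv_closed assms(1) by (simp add: carrier_BijGroup)
  show "(inv\<^bsub>BijGroup S\<^esub> g) (g x) = x" "g ((inv\<^bsub>BijGroup S\<^esub> g) x) = x"
    using l_inv[of g] r_inv[of g] assms BijGroup_mult_apply[of _ S _ x] i BijGroup_one_apply[of x S]
    by (metis carrier_BijGroup)+
qed

context
  fixes S :: "'a set" and \<Gamma> :: "('a \<Rightarrow> 'a) set"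
  assumes \<Gamma>: "subgroup \<Gamma> (BijGroup S)"
begin

lemma subgroup_BijGroup_subset: "g \<in> \<Gamma> \<Longrightarrow> g \<in> Bij S"
  using subgroup.subset[OF \<Gamma>] by (auto simp: carrier_BijGroup)

lemma group_orbitI: "g \<in> \<Gamma> \<Longrightarrow> y = g x \<Longrightarrow> y \<in> group_orbit \<Gamma> x"
  by (simp add: group_orbit_def)

lemma group_orbit_subset: "x \<in> S \<Longrightarrow> y \<in> group_orbit \<Gamma> x \<Longrightarrow> y \<in> S"
  by (auto simp: group_orbit_def Bij_apply_mem subgroup_BijGroup_subset)

lemma group_orbit_refl:
  assumes "x \<in> S"
  shows "x \<in> group_orbit \<Gamma> x"
  by (rule group_orbitI[OF subgroup.one_closed[OF \<Gamma>]]) (simp add: BijGroup_one_apply assms)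

lemma group_orbit_sym:
  assumes "x \<in> S" "y \<in> group_orbit \<Gamma> x"
  shows "x \<in> group_orbit \<Gamma> y"
proof -
  obtain g where g: "g \<in> \<Gamma>" "y = g x"
    using assms(2) by (auto simp: group_orbit_def)
  have "x = (inv\<^bsub>BijGroup S\<^esub> g) y"
    using BijGroup_inv_apply(1)[OF subgroup_BijGroup_subset[OF g(1)] assms(1)] g(2) by simp
  with subgroup.m_inv_closed[OF \<Gamma> g(1)] show ?thesis
    by (rule group_orbitI)
qed

lemma group_orbit_trans:
  assumes "x \<in> S" "y \<in> group_orbit \<Gamma> x" "z \<in> group_orbit \<Gamma> y"
  shows "z \<in> group_orbit \<Gamma> x"
proof -
  obtain g h where g: "g \<in> \<Gamma>" "y = g x" and h: "h \<in> \<Gamma>" "z = h y"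
    using assms(2,3) by (auto simp: group_orbit_def)
  have "z = (h \<otimes>\<^bsub>BijGroup S\<^esub> g) x"
    using BijGroup_mult_apply[of h S g x] g h assms(1) subgroup_BijGroup_subset by simp
  with subgroup.m_closed[OF \<Gamma> h(1) g(1)] show ?thesis
    by (rule group_orbitI)
qed

end

section \<open>The orbits of the odometer\<close>

text \<open>Presenting the integer powers as a generated subgroup makes induction over generators,
  inverses and products available.\<close>

lemma odometer_group_eq_generate:
  "odometer_group = generate (BijGroup (space odometer_space)) {odometer}"
  using group.generate_pow[OF group_BijGroup, of odometer "space odometer_space"] odometer_in_Bij
  by (auto simp: odometer_group_def carrier_BijGroup)

lemma subgroup_odometer_group: "subgroup odometer_group (BijGroup (space odometer_space))"
  unfolding odometer_group_eq_generate
  by (rule group.generate_is_subgroup[OF group_BijGroup])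
    (simp add: carrier_BijGroup odometer_in_Bij)

lemmas odometer_orbit_refl = group_orbit_refl[OF subgroup_odometer_group]
  and odometer_orbit_sym = group_orbit_sym[OF subgroup_odometer_group]
  and odometer_orbit_trans = group_orbit_trans[OF subgroup_odometer_group]
  and odometer_orbit_subset = group_orbit_subset[OF subgroup_odometer_group]

lemma odometer_mem_orbit: "odometer x \<in> group_orbit odometer_group x"
  by (auto simp: group_orbit_def odometer_group_eq_generate intro: generate.incl)

text \<open>The orbit relation is the least equivalence relation containing the graph of
  \<open>odometer\<close>; this principle replaces computations with integer powers.\<close>

lemma odometer_orbit_induct:
  assumes "x \<in> space odometer_space" "y \<in> group_orbit odometer_group x"
    and refl: "\<And>x. x \<in> space odometer_space \<Longrightarrow> Q x x"
    and sym: "\<And>x y. x \<in> space odometer_space \<Longrightarrow> y \<in> space odometer_space \<Longrightarrow> Q x y \<Longrightarrow> Q y x"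
    and trans: "\<And>x y z. x \<in> space odometer_space \<Longrightarrow> y \<in> space odometer_space \<Longrightarrow>
      z \<in> space odometer_space \<Longrightarrow> Q x y \<Longrightarrow> Q y z \<Longrightarrow> Q x z"
    and step: "\<And>x. x \<in> space odometer_space \<Longrightarrow> Q x (odometer x)"
  shows "Q x y"
proof -
  let ?\<Omega> = "space odometer_space"
  let ?G = "BijGroup ?\<Omega>"
  have sub: "g \<in> Bij ?\<Omega>" if "g \<in> generate ?G {odometer}" for g
    using that subgroup_BijGroup_subset[OF subgroup_odometer_group]
    by (simp add: odometer_group_eq_generate)
  have "Q x (g x)" if "g \<in> generate ?G {odometer}" "x \<in> ?\<Omega>" for g x
    using that
  proof (induction g arbitrary: x rule: generate.induct)
    case one
    then show ?case by (simp add: BijGroup_one_apply refl)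
  next
    case (incl h)
    then show ?case by (simp add: step)
  next
    case (inv h)
    have m: "(inv\<^bsub>?G\<^esub> h) x \<in> ?\<Omega>"
      using sub[OF generate.inv[OF inv(1)]] inv(2) by (rule Bij_apply_mem)
    have "h ((inv\<^bsub>?G\<^esub> h) x) = x"
      using BijGroup_inv_apply(2)[OF sub[OF generate.incl[OF inv(1)]] inv(2)] .
    then show ?case
      using sym[OF m _ step[OF m]] inv by auto
  next
    case (eng h1 h2)
    have "h2 x \<in> ?\<Omega>" "h1 (h2 x) \<in> ?\<Omega>"
      using eng.prems by (simp_all add: Bij_apply_mem sub eng.hyps)
    then show ?case
      using eng trans[of x "h2 x" "h1 (h2 x)"] sub by (simp add: BijGroup_mult_apply)
  qed
  then show ?thesis
    using assms(1,2) by (auto simp: group_orbit_def odometer_group_eq_generate)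
qed

section \<open>The odometer in terms of the first digit\<close>

lemma case_nat_mem_odometer_space:
  "a = 0 \<or> a = 1 \<Longrightarrow> y \<in> space odometer_space \<Longrightarrow> case_nat a y \<in> space odometer_space"
  by (auto simp: space_odometer_space split: nat.split)

lemma odometer_eqI:
  assumes "x \<in> space odometer_space" "x k \<noteq> 1" "\<And>i. i < k \<Longrightarrow> x i = 1"
  shows "odometer x = (\<lambda>i. if i < k then 0 else if i = k then 1 else x i)"
proof -
  have l: "(LEAST i. x i \<noteq> 1) = k"
    by (rule Least_equality) (use assms in \<open>auto simp: not_less[symmetric]\<close>)
  have n: "\<not> (\<forall>i. x i = 1)" using assms(2) by blast
  have "x k = 0" using assms(1,2) by (metis space_odometer_space)
  then show ?thesis
    by (simp only: odometer_def restrict_apply assms(1) n if_True if_False l Let_def add_0_left)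
qed

lemma odometer_all_ones: "odometer (\<lambda>i. 1) = (\<lambda>i. 0)"
  by (simp add: odometer_def space_odometer_space)

lemma odometer_case_nat_0:
  assumes "y \<in> space odometer_space"
  shows "odometer (case_nat 0 y) = case_nat 1 y"
  by (subst odometer_eqI[where k = 0])
    (auto simp: case_nat_mem_odometer_space assms fun_eq_iff split: nat.split)

text \<open>A leading 1 overflows to 0, and the carry acts on the remaining digits as one step of
  the odometer.\<close>

lemma odometer_case_nat_1:
  assumes "y \<in> space odometer_space"
  shows "odometer (case_nat 1 y) = case_nat 0 (odometer y)"
proof (cases "\<forall>i. y i = 1")
  case True
  then have "case_nat 1 y = (\<lambda>i. 1)" "y = (\<lambda>i. 1)"
    by (auto simp: fun_eq_iff split: nat.split)
  then have "odometer (case_nat 1 y) = (\<lambda>i. 0)" "odometer y = (\<lambda>i. 0)"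
    by (simp_all only: odometer_all_ones)
  then show ?thesis
    by (simp only: fun_eq_iff split: nat.split) simp
next
  case False
  define k where "k = (LEAST i. y i \<noteq> 1)"
  have "y k \<noteq> 1"
    unfolding k_def by (rule LeastI_ex) (use False in blast)
  moreover have "y i = 1" if "i < k" for i
    using not_less_Least[OF that[unfolded k_def]] by blast
  ultimately have k: "y k \<noteq> 1" "\<And>i. i < k \<Longrightarrow> y i = 1" .
  have "odometer (case_nat 1 y) =
      (\<lambda>i. if i < Suc k then 0 else if i = Suc k then 1 else case_nat 1 y i)"
    by (rule odometer_eqI)
      (use k case_nat_mem_odometer_space[OF _ assms, of 1] in \<open>auto split: nat.split\<close>)
  also have "\<dots> = case_nat 0 (odometer y)"
    using odometer_eqI[OF assms k] by (auto simp: fun_eq_iff split: nat.split)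
  finally show ?thesis .
qed

text \<open>Two steps of the odometer act on the sequence shifted by one as a single step.\<close>

lemma case_nat_mem_odometer_orbit:
  assumes x: "x \<in> space odometer_space" and y: "y \<in> group_orbit odometer_group x"
    and a: "a = 0 \<or> a = (1::nat)" and b: "b = 0 \<or> b = (1::nat)"
  shows "case_nat b y \<in> group_orbit odometer_group (case_nat a x)"
proof -
  let ?\<Omega> = "space odometer_space"
  let ?R = "\<lambda>x y. y \<in> group_orbit odometer_group x"
  have M: "case_nat 0 z \<in> ?\<Omega>" "case_nat 1 z \<in> ?\<Omega>" if "z \<in> ?\<Omega>" for z
    using that case_nat_mem_odometer_space by auto
  have S: "odometer z \<in> ?\<Omega>" if "z \<in> ?\<Omega>" for z
    using odometer_in_Bij that by (rule Bij_apply_mem)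
  have 01: "?R (case_nat 0 z) (case_nat 1 z)" if "z \<in> ?\<Omega>" for z
    using odometer_mem_orbit[of "case_nat 0 z"] odometer_case_nat_0[OF that] by simp
  have 10: "?R (case_nat 1 z) (case_nat 0 z)" if "z \<in> ?\<Omega>" for z
    using odometer_orbit_sym[OF M(1) 01] that by simp
  have 00: "?R (case_nat 0 x) (case_nat 0 y)"
    using x y
  proof (rule odometer_orbit_induct[where Q = "\<lambda>x y. ?R (case_nat 0 x) (case_nat 0 y)"])
    fix z assume z: "z \<in> ?\<Omega>"
    \<comment> \<open>The first step turns the leading 0 into 1, the second one carries into
      \<open>z\<close>.\<close>
    show "?R (case_nat 0 z) (case_nat 0 (odometer z))"
      using odometer_orbit_trans[OF M(1) 01] odometer_mem_orbit[of "case_nat 1 z"] z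
        odometer_case_nat_1[OF z] by simp
  next
    fix u v w assume "u \<in> ?\<Omega>" "?R (case_nat 0 u) (case_nat 0 v)" "?R (case_nat 0 v) (case_nat 0 w)"
    then show "?R (case_nat 0 u) (case_nat 0 w)"
      using odometer_orbit_trans[OF M(1)] by simp
  qed (simp_all add: odometer_orbit_refl odometer_orbit_sym M(1))
  have y': "y \<in> ?\<Omega>"
    using odometer_orbit_subset[OF x y] .
  have b0: "?R (case_nat 0 x) (case_nat b y)"
    using 00 odometer_orbit_trans[OF M(1)[OF x] 00 01[OF y']] b by auto
  then show ?thesis
    using b0 odometer_orbit_trans[OF M(2)[OF x] 10[OF x] b0] a by auto
qed

text \<open>Dropping the first digit lowers the index of agreement by one; the dropped digits, equal
  or not, can be put back without leaving the orbit.\<close>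

lemma tail_eq_mem_odometer_orbit:
  assumes "x \<in> space odometer_space" "y \<in> space odometer_space" "\<And>i. i \<ge> n \<Longrightarrow> x i = y i"
  shows "y \<in> group_orbit odometer_group x"
  using assms
proof (induction n arbitrary: x y)
  case 0
  then have "x = y" by auto
  then show ?case using 0 odometer_orbit_refl by simp
next
  case (Suc n)
  have eq: "z = case_nat (z 0) (\<lambda>i. z (Suc i))" for z :: "nat \<Rightarrow> nat"
    by (auto simp: fun_eq_iff split: nat.split)
  have "(\<lambda>i. y (Suc i)) \<in> group_orbit odometer_group (\<lambda>i. x (Suc i))"
    by (rule Suc.IH) (use Suc.prems in \<open>auto simp: space_odometer_space\<close>)
  then have "case_nat (y 0) (\<lambda>i. y (Suc i)) \<in>
      group_orbit odometer_group (case_nat (x 0) (\<lambda>i. x (Suc i)))"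
    by (intro case_nat_mem_odometer_orbit) (use Suc.prems in \<open>auto simp: space_odometer_space\<close>)
  then show ?case using eq by metis
qed

section \<open>Orbits, tails and truncations\<close>

definition eventually_constant :: "(nat \<Rightarrow> nat) \<Rightarrow> bool" where
  "eventually_constant x \<longleftrightarrow> (\<exists>m. \<forall>i\<ge>m. x i = x m)"

lemma eventually_constant_tail:
  assumes "eventually_constant x" "\<And>i. i \<ge> n \<Longrightarrow> x i = y i"
  shows "eventually_constant y"
proof -
  obtain m where m: "\<And>i. i \<ge> m \<Longrightarrow> x i = x m"
    using assms(1) by (auto simp: eventually_constant_def)
  have "y i = y (max m n)" if "i \<ge> max m n" for i
    using m[of i] m[of "max m n"] assms(2)[of i] assms(2)[of "max m n"] that by simp
  then have "\<forall>i\<ge>max m n. y i = y (max m n)" by blast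
  then show ?thesis unfolding eventually_constant_def by blast
qed

text \<open>One step changes only the digits up to the first one that is not 1, except at the
  sequence of all ones, where both the point and its image are constant. It then suffices that the
  disjunction defines an equivalence relation.\<close>

lemma odometer_orbit_imp_tail_eq:
  assumes "x \<in> space odometer_space" "y \<in> group_orbit odometer_group x"
  shows "eventually_constant x \<and> eventually_constant y \<or> (\<exists>n. \<forall>i\<ge>n. x i = y i)"
  using assms
proof (rule odometer_orbit_induct)
  fix x y z :: "nat \<Rightarrow> nat"
  assume xy: "eventually_constant x \<and> eventually_constant y \<or> (\<exists>n. \<forall>i\<ge>n. x i = y i)"
    and yz: "eventually_constant y \<and> eventually_constant z \<or> (\<exists>n. \<forall>i\<ge>n. y i = z i)"
  show "eventually_constant x \<and> eventually_constant z \<or> (\<exists>n. \<forall>i\<ge>n. x i = z i)"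
  proof (cases "eventually_constant y")
    \<comment> \<open>Eventual constancy passes from \<open>y\<close> to both \<open>x\<close> and
      \<open>z\<close>, whichever alternative relates them to \<open>y\<close>.\<close>
    case True
    then show ?thesis
      using xy yz eventually_constant_tail by metis
  next
    case False
    then obtain n m where "\<forall>i\<ge>n. x i = y i" "\<forall>i\<ge>m. y i = z i"
      using xy yz by auto
    then have "\<forall>i\<ge>max n m. x i = z i" by auto
    then show ?thesis by blast
  qed
next
  fix x assume x: "x \<in> space odometer_space"
  show "eventually_constant x \<and> eventually_constant (odometer x) \<or> (\<exists>n. \<forall>i\<ge>n. x i = odometer x i)"
  proof (cases "\<forall>i. x i = 1")
    case True
    then show ?thesis using x by (auto simp: eventually_constant_def odometer_def)
  next
    case False
    then have "\<forall>i\<ge>Suc (LEAST i. x i \<noteq> 1). x i = odometer x i"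
      using x by (auto simp: odometer_def Let_def)
    then show ?thesis by blast
  qed
qed (auto, metis+)

text \<open>The truncations witness hyperfiniteness: the orbit relation is the increasing union of the
  kernels of \<open>trunc n\<close>. The orbit of all eventually constant sequences needs separate treatment,
  since it contains the two distinct tails \<open>0, 0, \<dots>\<close> and \<open>1, 1, \<dots>\<close>.\<close>

definition trunc :: "nat \<Rightarrow> (nat \<Rightarrow> nat) \<Rightarrow> nat \<Rightarrow> nat" where
  "trunc n x = (\<lambda>i. if i < n \<or> n > 0 \<and> eventually_constant x then 0 else x i)"

text \<open>The guard \<open>n > 0\<close> in \<open>trunc\<close> serves this case: even an
  eventually constant sequence is its own truncation at index 0.\<close>

lemma trunc_0: "trunc 0 x = x"
  by (simp add: trunc_def)

text \<open>Each truncation is thus a function of the preceding one, so that two points once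
  identified stay identified. Outside the collapsed case, \<open>trunc n\<close> keeps the tail and
  hence also whether the sequence is eventually constant.\<close>

lemma trunc_Suc_trunc: "trunc (Suc n) (trunc n x) = trunc (Suc n) x"
proof (cases "n > 0 \<and> eventually_constant x")
  case True
  then show ?thesis by (auto simp: trunc_def eventually_constant_def)
next
  case False
  then have "\<forall>i\<ge>n. trunc n x i = x i" by (auto simp: trunc_def)
  then have "eventually_constant (trunc n x) \<longleftrightarrow> eventually_constant x"
    using eventually_constant_tail[of x n "trunc n x"] eventually_constant_tail[of "trunc n x" n x]
    by auto
  then show ?thesis by (auto simp: trunc_def)
qed

text \<open>The sequence shares its tail with a constant one, and a single step leads from all ones
  to all zeros.\<close>

lemma eventually_constant_orbit:
  assumes x: "x \<in> space odometer_space" and e: "eventually_constant x"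
  shows "(\<lambda>i. 0) \<in> group_orbit odometer_group x"
proof -
  obtain m where m: "\<And>i. i \<ge> m \<Longrightarrow> x i = x m"
    using e by (auto simp: eventually_constant_def)
  have c: "(\<lambda>i. x m) \<in> space odometer_space"
    using x by (auto simp: space_odometer_space)
  have 1: "(\<lambda>i. x m) \<in> group_orbit odometer_group x"
    using x c m by (rule tail_eq_mem_odometer_orbit)
  show ?thesis
  proof (cases "x m = 0")
    case True
    then show ?thesis using 1 by simp
  next
    case False
    then have "x m = 1" using x by (metis space_odometer_space)
    then have "odometer (\<lambda>i. x m) = (\<lambda>i. 0)"
      using odometer_all_ones by simp
    then show ?thesis
      using odometer_orbit_trans[OF x 1] odometer_mem_orbit by metis
  qed
qed

lemma trunc_mem_orbit:
  assumes x: "x \<in> space odometer_space"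
  shows "trunc n x \<in> group_orbit odometer_group x"
proof (cases "n > 0 \<and> eventually_constant x")
  case True
  then show ?thesis
    using eventually_constant_orbit[OF x] by (simp add: trunc_def)
next
  case False
  then show ?thesis
    using x by (intro tail_eq_mem_odometer_orbit[of _ _ n]) (auto simp: trunc_def space_odometer_space)
qed

lemma orbit_imp_trunc_eq:
  assumes "x \<in> space odometer_space" "y \<in> group_orbit odometer_group x"
  shows "\<exists>n. trunc n x = trunc n y"
proof (cases "eventually_constant x \<and> eventually_constant y")
  case True
  \<comment> \<open>Index 1 is the first at which every eventually constant sequence becomes
    zero.\<close>
  then have "trunc 1 x = trunc 1 y" by (simp add: trunc_def)
  then show ?thesis ..
next
  case False
  then obtain n where n: "\<forall>i\<ge>n. x i = y i"
    using odometer_orbit_imp_tail_eq[OF assms] by blast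
  \<comment> \<open>Equal tails put \<open>x\<close> and \<open>y\<close> into the same case of
    \<open>trunc\<close>.\<close>
  then have "eventually_constant x \<longleftrightarrow> eventually_constant y"
    using eventually_constant_tail[of x n y] eventually_constant_tail[of y n x] by auto
  with n have "trunc n x = trunc n y"
    by (auto simp: trunc_def fun_eq_iff)
  then show ?thesis ..
qed

section \<open>Measurability on the odometer space\<close>

lemma measurable_odometer_space_component:
  "(\<lambda>x. x i) \<in> measurable odometer_space (count_space UNIV)"
proof -
  have "(\<lambda>x. x i) \<in> measurable odometer_space (count_space {0, 1})"
    unfolding odometer_space_def by (rule measurable_component_singleton) simp
  then show ?thesis
    by (rule measurable_compose) simp
qed

lemma measurable_trunc: "trunc n \<in> measurable odometer_space odometer_space"
proof -
  note measurable_odometer_space_component[measurable]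
  have [measurable]: "Measurable.pred odometer_space eventually_constant"
    unfolding eventually_constant_def by measurable
  have "(\<lambda>x. trunc n x i) \<in> measurable odometer_space (count_space UNIV)" for i
    unfolding trunc_def by measurable
  \<comment> \<open>The codomain can be narrowed because truncation keeps all digits in
    \<open>{0, 1}\<close>.\<close>
  then have "(\<lambda>x. trunc n x i) \<in> measurable odometer_space (count_space {0, 1})" for i
    by (simp add: measurable_count_space_eq2_countable measurable_count_space_eq2 Pi_iff)
      (auto simp: trunc_def space_odometer_space)
  then show ?thesis
    by (subst (2) odometer_space_def, intro measurable_PiM_single') 
      (auto simp: PiE_def trunc_def space_odometer_space)
qed

lemma sets_Collect_eq_odometer_space:
  assumes "f \<in> measurable M odometer_space" "g \<in> measurable M odometer_space"
  shows "{x \<in> space M. f x = g x} \<in> sets M"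
proof -
  have [measurable]: "(\<lambda>x. f x i) \<in> measurable M (count_space UNIV)"
    "(\<lambda>x. g x i) \<in> measurable M (count_space UNIV)" for i
    by (rule measurable_compose[OF _ measurable_odometer_space_component], rule assms)+
  \<comment> \<open>Naming the common digit \<open>a\<close> leaves countably many conditions, each
    on \<open>f\<close> or on \<open>g\<close> alone.\<close>
  have "(f x = g x) = (\<forall>i. \<exists>a. f x i = a \<and> g x i = a)" for x
    by (auto simp: fun_eq_iff)
  then show ?thesis by (simp only:) measurable
qed

section \<open>Convergence in locally compact groups\<close>

lemma borel_measurable_diff_group:
  fixes f g :: "'a \<Rightarrow> 'g::{second_countable_topology, topological_group_add}"
  assumes "f \<in> borel_measurable M" "g \<in> borel_measurable M"
  shows "(\<lambda>x. f x - g x) \<in> borel_measurable M"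
proof -
  have "(\<lambda>x. - g x) \<in> borel_measurable M"
    using assms(2)
    by (rule measurable_compose) (intro borel_measurable_continuous_onI continuous_intros)
  then show ?thesis
    using borel_measurable_add[OF assms(1)] by (simp only: diff_conv_add_uminus)
qed

text \<open>Each point is sent to the first element, in an enumeration of \<open>H\<close>, that is
  \<open>U\<close>-close to it; density provides one. The least index is a Borel function because
  closeness to a fixed element is an open condition.\<close>

lemma dense_borel_approximation:
  fixes H :: "'g::topological_ab_group_add set"
  assumes H: "countable H" "closure H = UNIV" and U: "open U" "0 \<in> U"
  obtains q where "q \<in> measurable borel borel" "\<And>g. q g \<in> H" "\<And>g. q g - g \<in> U"
proof
  define k where "k g = (LEAST k. from_nat_into H k - g \<in> U)" for g
  have ne: "H \<noteq> {}" using H(2) by auto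
  have "\<exists>k. from_nat_into H k - g \<in> U" for g
  proof -
    have "open ((\<lambda>h. h - g) -` U)"
      by (intro open_vimage U continuous_intros)
    moreover have "g \<in> (\<lambda>h. h - g) -` U \<inter> closure H"
      using U H by simp
    ultimately obtain h where "h \<in> H" "h - g \<in> U"
      using open_Int_closure_eq_empty[of "(\<lambda>h. h - g) -` U" H] by blast
    then show ?thesis
      using H(1) by (metis from_nat_into_surj)
  qed
  then show "from_nat_into H (k g) - g \<in> U" for g
    unfolding k_def by (rule LeastI_ex)
  show "from_nat_into H (k g) \<in> H" for g
    using ne by (rule from_nat_into)
  have [measurable]: "Measurable.pred borel (\<lambda>g. from_nat_into H j - g \<in> U)" for j
  proof -
    have "open ((\<lambda>g. from_nat_into H j - g) -` U)"
      by (intro open_vimage U continuous_intros)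
    then have "(\<lambda>g. from_nat_into H j - g) -` U \<in> sets borel" by (rule borel_open)
    then show ?thesis by (simp add: pred_def vimage_def)
  qed
  have "k \<in> measurable borel (count_space UNIV)"
    unfolding k_def by measurable
  then show "(\<lambda>g. from_nat_into H (k g)) \<in> measurable borel borel"
    by (rule measurable_compose) simp
qed

text \<open>Such a sequence plays the role of a translation invariant metric.\<close>

definition summable_nbhds :: "(nat \<Rightarrow> 'g::topological_ab_group_add set) \<Rightarrow> bool" where
  "summable_nbhds U \<longleftrightarrow>
     (\<forall>n. open (U n) \<and> 0 \<in> U n \<and> (\<forall>a\<in>U n. - a \<in> U n)) \<and>
     (\<forall>n. \<forall>a\<in>U (Suc n). \<forall>b\<in>U (Suc n). a + b \<in> U n) \<and>
     (\<forall>S. open S \<longrightarrow> 0 \<in> S \<longrightarrow> (\<exists>n. U n \<subseteq> S))"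

text \<open>Continuity of addition at \<open>(0, 0)\<close> gives neighbourhoods \<open>A\<close>
  and \<open>B\<close> with sums in \<open>S\<close>; their intersection is then made
  symmetric.\<close>

lemma symmetric_half_nbhd:
  fixes S :: "'g::topological_ab_group_add set"
  assumes "open S" "0 \<in> S"
  obtains V where "open V" "0 \<in> V" "\<forall>a\<in>V. - a \<in> V" "\<forall>a\<in>V. \<forall>b\<in>V. a + b \<in> S"
proof -
  have "((\<lambda>(a, b). a + b) \<longlongrightarrow> (0 + 0 :: 'g)) (nhds 0 \<times>\<^sub>F nhds 0)"
    unfolding case_prod_beta
    by (intro tendsto_add tendsto_fst tendsto_snd) 
      (simp_all add: filterlim_fst filterlim_snd)
  then have "\<forall>\<^sub>F p in nhds 0 \<times>\<^sub>F nhds 0. (\<lambda>(a, b). a + b) p \<in> S"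
    by (rule topological_tendstoD) (use assms in auto)
  then obtain P Q where "\<forall>\<^sub>F a in nhds (0::'g). P a" "\<forall>\<^sub>F a in nhds (0::'g). Q a"
    and PQ: "\<And>a b. P a \<Longrightarrow> Q b \<Longrightarrow> a + b \<in> S"
    unfolding eventually_prod_filter by auto
  then obtain A B where A: "open A" "0 \<in> A" "\<And>a. a \<in> A \<Longrightarrow> P a"
    and B: "open B" "0 \<in> B" "\<And>a. a \<in> B \<Longrightarrow> Q a"
    unfolding eventually_nhds by auto
  define V where "V = (A \<inter> B) \<inter> uminus -` (A \<inter> B)"
  show ?thesis
  proof
    show "open V"
      unfolding V_def by (intro open_Int A B open_vimage continuous_intros)
    show "0 \<in> V" "\<forall>a\<in>V. - a \<in> V" using A B by (auto simp: V_def)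
    show "\<forall>a\<in>V. \<forall>b\<in>V. a + b \<in> S" using A B PQ by (auto simp: V_def)
  qed
qed

text \<open>Dependent choice: each neighbourhood is a symmetric half of its predecessor, and the
  \<open>n\<close>-th is kept inside the \<open>n\<close>-th member of a countable base at 0, so
  that the sequence is itself a base.\<close>

lemma summable_nbhds_exist:
  fixes W :: "'g::{topological_ab_group_add, first_countable_topology} set"
  assumes W: "open W" "0 \<in> W"
  obtains U where "summable_nbhds U" "U 0 \<subseteq> W"
proof -
  obtain A :: "nat \<Rightarrow> 'g set" where A: "\<And>i. open (A i)" "\<And>i. 0 \<in> A i"
    "\<And>S. open S \<Longrightarrow> 0 \<in> S \<Longrightarrow> eventually (\<lambda>i. A i \<subseteq> S) sequentially"
    using countable_basis_at_decseq[of "0::'g"] by blast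
  define P where "P n V \<longleftrightarrow> open V \<and> 0 \<in> V \<and> (\<forall>a\<in>V. - a \<in> V) \<and> V \<subseteq> W \<inter> A n"
    for n and V :: "'g set"
  have ex: "\<exists>V. P n V \<and> (\<forall>a\<in>V. \<forall>b\<in>V. a + b \<in> X)" if X: "open X" "0 \<in> X" for X n
  proof -
    obtain V where V: "open V" "0 \<in> V" "\<forall>a\<in>V. - a \<in> V" "\<forall>a\<in>V. \<forall>b\<in>V. a + b \<in> X \<inter> W \<inter> A n"
      by (rule symmetric_half_nbhd[of "X \<inter> W \<inter> A n"]) (use X W A in auto)
    \<comment> \<open>Taking 0 as the second summand turns the condition on sums into an
      inclusion.\<close>
    have "a \<in> W \<inter> A n" if "a \<in> V" for a
      using V(4)[rule_format, OF that V(2)] by simp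
    with V have "P n V \<and> (\<forall>a\<in>V. \<forall>b\<in>V. a + b \<in> X)" by (auto simp: P_def)
    then show ?thesis ..
  qed
  have "\<exists>U. \<forall>n. P n (U n) \<and> (\<forall>a\<in>U (Suc n). \<forall>b\<in>U (Suc n). a + b \<in> U n)"
  proof (rule dependent_nat_choice)
    show "\<exists>V. P 0 V" using ex[of UNIV 0] by auto
    show "\<exists>V. P (Suc n) V \<and> (\<forall>a\<in>V. \<forall>b\<in>V. a + b \<in> X)" if "P n X" for X n
      using that by (intro ex) (auto simp: P_def)
  qed
  then obtain U where U: "\<And>n. P n (U n)" "\<And>n. \<forall>a\<in>U (Suc n). \<forall>b\<in>U (Suc n). a + b \<in> U n"
    by blast
  have "\<exists>n. U n \<subseteq> S" if S: "open S" "0 \<in> S" for S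
  proof -
    obtain n where "A n \<subseteq> S"
      using A(3)[OF S] by (auto simp: eventually_sequentially)
    then have "U n \<subseteq> S" using U(1)[of n] by (auto simp: P_def)
    then show ?thesis ..
  qed
  with U have "summable_nbhds U"
    by (auto simp: summable_nbhds_def P_def)
  moreover have "U 0 \<subseteq> W" using U(1)[of 0] by (simp add: P_def)
  ultimately show ?thesis by (rule that)
qed

section \<open>Series with terms in shrinking neighbourhoods\<close>

context
  fixes U :: "nat \<Rightarrow> 'g::{topological_ab_group_add, second_countable_topology, t2_space} set"
  assumes U: "summable_nbhds U"
begin

lemma summable_nbhdsD:
  shows "open (U n)" "0 \<in> U n" "a \<in> U n \<Longrightarrow> - a \<in> U n"
    "a \<in> U (Suc n) \<Longrightarrow> b \<in> U (Suc n) \<Longrightarrow> a + b \<in> U n"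
    "open S \<Longrightarrow> 0 \<in> S \<Longrightarrow> \<exists>n. U n \<subseteq> S"
  using U by (auto simp: summable_nbhds_def)

lemma summable_nbhds_antimono: "m \<le> n \<Longrightarrow> a \<in> U n \<Longrightarrow> a \<in> U m"
proof (induction n rule: dec_induct)
  case (step n)
  then show ?case using summable_nbhdsD(4)[of a n 0] summable_nbhdsD(2) by simp
qed

lemma summable_nbhds_near:
  assumes "open S" "x \<in> S"
  obtains n where "\<And>u. u \<in> U n \<Longrightarrow> x + u \<in> S"
proof -
  have "open ((\<lambda>u. x + u) -` S)"
    by (intro open_vimage assms continuous_intros)
  then obtain n where "U n \<subseteq> (\<lambda>u. x + u) -` S"
    using summable_nbhdsD(5) assms(2) by force
  then show ?thesis by (intro that) auto
qed

lemma open_summable_nbhd_translate: "open {g. g - x \<in> U n}"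
proof -
  have "open ((\<lambda>g. g - x) -` U n)"
    by (intro open_vimage summable_nbhdsD continuous_intros)
  then show ?thesis by (simp add: vimage_def)
qed

context
  fixes r :: "nat \<Rightarrow> 'g"
  assumes r: "\<And>i. r i \<in> U (Suc i)"
begin

text \<open>The analogue of the geometric bound, uniform in \<open>m\<close>. By induction downwards
  from \<open>m\<close>, the first term and the rest of the block both lie in
  \<open>U (Suc n)\<close>, so their sum lies in \<open>U n\<close>.\<close>

lemma sum_block_mem: "(\<Sum>i=n..<m. r i) \<in> U n"
proof (cases "n \<le> m")
  case True
  then show ?thesis
  proof (induction n rule: inc_induct)
    case base
    then show ?case by (simp add: summable_nbhdsD)
  next
    case (step n)
    then show ?case
      using summable_nbhdsD(4)[OF r step.IH] by (simp add: sum.atLeast_Suc_lessThan)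
  qed
qed (simp add: summable_nbhdsD)

lemma partial_sums_diff_mem:
  assumes "n \<le> m"
  shows "(\<Sum>i<m. r i) - (\<Sum>i<n. r i) \<in> U n"
proof -
  have "(\<Sum>i<m. r i) = (\<Sum>i<n. r i) + (\<Sum>i=n..<m. r i)"
    using assms by (simp add: sum.atLeastLessThan_concat lessThan_atLeast0)
  then show ?thesis using sum_block_mem by simp
qed

text \<open>All partial sums lie in \<open>U 0\<close>, hence in \<open>K\<close>, so a subsequence
  converges; the Cauchy estimate extends convergence to the whole sequence.\<close>

lemma partial_sums_converge:
  assumes "compact K" "U 0 \<subseteq> K"
  shows "\<exists>l. (\<lambda>m. \<Sum>i<m. r i) \<longlonglongrightarrow> l"
proof -
  let ?s = "\<lambda>m. \<Sum>i<m. r i"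
  have "?s m \<in> K" for m
    using partial_sums_diff_mem[of 0 m] assms(2) by auto
  then obtain l k where l: "strict_mono (k :: nat \<Rightarrow> nat)" "(?s \<circ> k) \<longlonglongrightarrow> l"
    using compact_imp_seq_compact[OF assms(1)] unfolding seq_compact_def by metis
  have "?s \<longlonglongrightarrow> l"
  proof (rule topological_tendstoI)
    fix S assume "open S" "l \<in> S"
    then obtain n where n: "\<And>u. u \<in> U n \<Longrightarrow> l + u \<in> S"
      using summable_nbhds_near by blast
    have "\<forall>\<^sub>F j in sequentially. (?s \<circ> k) j \<in> {g. g - l \<in> U (Suc (Suc n))}"
      using l(2) open_summable_nbhd_translate by (rule topological_tendstoD) (simp add: summable_nbhdsD)
    then obtain j where j: "j \<ge> Suc (Suc n)" "?s (k j) - l \<in> U (Suc (Suc n))"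
      by (auto simp: eventually_sequentially) (metis nle_le)
    have kj: "k j \<ge> Suc (Suc n)" using seq_suble[OF l(1), of j] j(1) by simp
    have "?s m \<in> S" if m: "m \<ge> Suc (Suc n)" for m
    proof -
      let ?t = "?s (Suc (Suc n))"
      \<comment> \<open>Three terms in \<open>U (Suc (Suc n))\<close>: the two additions use up the
        two spare indices.\<close>
      have "?s m - l = ((?s m - ?t) + - (?s (k j) - ?t)) + (?s (k j) - l)" by simp
      also have "\<dots> \<in> U n"
        using partial_sums_diff_mem[OF m] partial_sums_diff_mem[OF kj] j(2)
        by (intro summable_nbhdsD(4) summable_nbhdsD(3) summable_nbhds_antimono[of "Suc n" "Suc (Suc n)"]) auto
      finally show ?thesis using n[of "?s m - l"] by simp
    qed
    then show "\<forall>\<^sub>F m in sequentially. ?s m \<in> S"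
      unfolding eventually_sequentially by blast
  qed
  then show ?thesis ..
qed

text \<open>The rate depends on \<open>n\<close> alone, so convergence is uniform in any parameter.
  One index is lost in comparing the limit with a late partial sum.\<close>

lemma limit_diff_partial_sum_mem:
  assumes l: "(\<lambda>m. \<Sum>i<m. r i) \<longlonglongrightarrow> l"
  shows "l - (\<Sum>i<Suc n. r i) \<in> U n"
proof -
  have "\<forall>\<^sub>F m in sequentially. (\<Sum>i<m. r i) \<in> {g. g - l \<in> U (Suc n)}"
    using l open_summable_nbhd_translate by (rule topological_tendstoD) (simp add: summable_nbhdsD)
  then obtain m where m: "m \<ge> Suc n" "(\<Sum>i<m. r i) - l \<in> U (Suc n)"
    by (auto simp: eventually_sequentially) (metis nle_le)
  have "l - (\<Sum>i<Suc n. r i) = - ((\<Sum>i<m. r i) - l) + ((\<Sum>i<m. r i) - (\<Sum>i<Suc n. r i))"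
    by simp
  also have "\<dots> \<in> U n"
    using m by (intro summable_nbhdsD(3,4) partial_sums_diff_mem) auto
  finally show ?thesis .
qed

end

text \<open>A uniform limit of measurable maps, treated without a metric: the preimage of an open
  set is a countable union of preimages under partial sums.\<close>

lemma borel_measurable_sum_limit:
  fixes r :: "nat \<Rightarrow> 'a \<Rightarrow> 'g"
  assumes meas: "\<And>i. r i \<in> borel_measurable M"
    and r: "\<And>i x. x \<in> space M \<Longrightarrow> r i x \<in> U (Suc i)"
    and c: "\<And>x. x \<in> space M \<Longrightarrow> (\<lambda>m. \<Sum>i<m. r i x) \<longlonglongrightarrow> c x"
  shows "c \<in> borel_measurable M"
proof (rule borel_measurableI)
  fix V :: "'g set" assume V: "open V"
  define s where "s n x = (\<Sum>i<Suc n. r i x)" for n x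
  \<comment> \<open>The points that remain in \<open>V\<close> under errors from \<open>U n\<close>;
    the interior makes \<open>W n\<close> Borel.\<close>
  define W where "W n = interior {g. \<forall>u\<in>U n. g + u \<in> V}" for n
  have tail: "c x - s n x \<in> U n" if "x \<in> space M" for n x
    unfolding s_def by (rule limit_diff_partial_sum_mem) (use r c that in auto)
  have 1: "c x \<in> V" if x: "x \<in> space M" "s n x \<in> W n" for x n
  proof -
    have "s n x \<in> {g. \<forall>u\<in>U n. g + u \<in> V}"
      using x(2) interior_subset unfolding W_def by blast
    then have "s n x + (c x - s n x) \<in> V" using tail[OF x(1)] by blast
    then show ?thesis by simp
  qed
  have 2: "\<exists>n. s n x \<in> W n" if x: "x \<in> space M" "c x \<in> V" for x
  proof -
    obtain k where k: "\<And>u. u \<in> U k \<Longrightarrow> c x + u \<in> V"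
      using summable_nbhds_near[OF V x(2)] by blast
    let ?n = "Suc (Suc k)"
    \<comment> \<open>A whole neighbourhood of \<open>s ?n x\<close> is needed to reach the
      interior. The three errors, all in \<open>U ?n\<close>, add up to an element of
      \<open>U k\<close>.\<close>
    have "{g. g - s ?n x \<in> U ?n} \<subseteq> {g. \<forall>u\<in>U ?n. g + u \<in> V}"
    proof safe
      fix g u assume g: "g - s ?n x \<in> U ?n" "u \<in> U ?n"
      have "- (c x - s ?n x) + ((g - s ?n x) + u) \<in> U k"
        using summable_nbhdsD(3)[OF tail[OF x(1), of ?n]] g
        by (intro summable_nbhdsD(4) summable_nbhds_antimono[of "Suc k" ?n]) auto
      then have "c x + (- (c x - s ?n x) + ((g - s ?n x) + u)) \<in> V" by (rule k)
      moreover have "c x + (- (c x - s ?n x) + ((g - s ?n x) + u)) = g + u" by simp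
      ultimately show "g + u \<in> V" by simp
    qed
    moreover have "s ?n x \<in> {g. g - s ?n x \<in> U ?n}" by (simp add: summable_nbhdsD)
    ultimately have "s ?n x \<in> W ?n"
      unfolding W_def using open_summable_nbhd_translate by (intro interiorI)
    then show ?thesis ..
  qed
  have "c -` V \<inter> space M = (\<Union>n. s n -` W n \<inter> space M)"
  proof (rule Set.set_eqI)
    show "x \<in> c -` V \<inter> space M \<longleftrightarrow> x \<in> (\<Union>n. s n -` W n \<inter> space M)" for x
      using 1[of x] 2[of x] by auto
  qed
  moreover have "s n \<in> borel_measurable M" for n
    unfolding s_def using meas by (intro borel_measurable_sum)
  then have "s n -` W n \<inter> space M \<in> sets M" for n
    by (rule measurable_sets) (simp add: W_def)
  then have "(\<Union>n. s n -` W n \<inter> space M) \<in> sets M"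
    by (intro sets.countable_UN image_subsetI)
  ultimately show "c -` V \<inter> space M \<in> sets M" by (simp only:)
qed

end

section \<open>Cocycles of free actions\<close>

text \<open>By freeness a cocycle is a function of the two endpoints.\<close>

definition orbit_cocycle :: "('a \<Rightarrow> 'a) set \<Rightarrow> (('a \<Rightarrow> 'a) \<Rightarrow> 'a \<Rightarrow> 'g) \<Rightarrow> 'a \<Rightarrow> 'a \<Rightarrow> 'g" where
  "orbit_cocycle \<Gamma> a y x = a (THE \<gamma>. \<gamma> \<in> \<Gamma> \<and> \<gamma> x = y) x"

context
  fixes M :: "'a measure" and \<Gamma> :: "('a \<Rightarrow> 'a) set"
  assumes \<Gamma>: "countable_borel_group M \<Gamma>" and free: "acts_freely M \<Gamma>"
begin

lemma borel_group_subgroup: "subgroup \<Gamma> (BijGroup (space M))"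
  and borel_group_measurable: "\<gamma> \<in> \<Gamma> \<Longrightarrow> \<gamma> \<in> measurable M M"
  and borel_group_countable: "countable \<Gamma>"
  using \<Gamma> by (auto simp: countable_borel_group_def borel_automorphisms_def)

lemma borel_group_apply_mem: "\<gamma> \<in> \<Gamma> \<Longrightarrow> x \<in> space M \<Longrightarrow> \<gamma> x \<in> space M"
  using measurable_space[OF borel_group_measurable] .

lemma borel_group_mult_apply:
  "\<gamma> \<in> \<Gamma> \<Longrightarrow> \<delta> \<in> \<Gamma> \<Longrightarrow> x \<in> space M \<Longrightarrow> (\<gamma> \<otimes>\<^bsub>BijGroup (space M)\<^esub> \<delta>) x = \<gamma> (\<delta> x)"
  by (simp add: BijGroup_mult_apply subgroup_BijGroup_subset[OF borel_group_subgroup])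

text \<open>The product of the inverse of \<open>\<delta>\<close> with \<open>\<gamma>\<close> fixes
  \<open>x\<close>, so freeness makes it the identity.\<close>

lemma free_action_unique:
  assumes g: "\<gamma> \<in> \<Gamma>" "\<delta> \<in> \<Gamma>" and x: "x \<in> space M" "\<gamma> x = \<delta> x"
  shows "\<gamma> = \<delta>"
proof -
  let ?G = "BijGroup (space M)"
  interpret group ?G by (rule group_BijGroup)
  have i: "inv\<^bsub>?G\<^esub> \<delta> \<in> \<Gamma>" "inv\<^bsub>?G\<^esub> \<delta> \<otimes>\<^bsub>?G\<^esub> \<gamma> \<in> \<Gamma>"
    using g borel_group_subgroup by (auto intro: subgroup.m_inv_closed subgroup.m_closed)
  have c: "\<gamma> \<in> carrier ?G" "\<delta> \<in> carrier ?G"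
    using g subgroup.subset[OF borel_group_subgroup] by auto
  have "(inv\<^bsub>?G\<^esub> \<delta> \<otimes>\<^bsub>?G\<^esub> \<gamma>) x = x"
    using g i x BijGroup_inv_apply(1)[of \<delta> "space M" x] c
    by (simp add: borel_group_mult_apply carrier_BijGroup)
  then have "inv\<^bsub>?G\<^esub> \<delta> \<otimes>\<^bsub>?G\<^esub> \<gamma> = \<one>\<^bsub>?G\<^esub>"
    using free i(2) x(1) by (auto simp: acts_freely_def)
  then have "inv\<^bsub>?G\<^esub> (inv\<^bsub>?G\<^esub> \<delta>) = \<gamma>"
    using c by (intro inv_equality) (auto simp: inv_comm)
  then show ?thesis using c by simp
qed

lemma free_action_The:
  "\<gamma> \<in> \<Gamma> \<Longrightarrow> x \<in> space M \<Longrightarrow> (THE \<delta>. \<delta> \<in> \<Gamma> \<and> \<delta> x = \<gamma> x) = \<gamma>"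
  by (rule the_equality) (auto intro: free_action_unique)

lemma orbit_cocycle_eq:
  "\<gamma> \<in> \<Gamma> \<Longrightarrow> x \<in> space M \<Longrightarrow> orbit_cocycle \<Gamma> a (\<gamma> x) x = a \<gamma> x"
  by (simp add: orbit_cocycle_def free_action_The)

text \<open>The cocycle identity for endpoints: the element carrying \<open>x\<close> to
  \<open>z\<close> is the product of those carrying \<open>x\<close> to \<open>y\<close> and
  \<open>y\<close> to \<open>z\<close>.\<close>

lemma orbit_cocycle_add:
  assumes a: "cocycle M \<Gamma> a" and x: "x \<in> space M"
    and y: "y \<in> group_orbit \<Gamma> x" and z: "z \<in> group_orbit \<Gamma> y"
  shows "orbit_cocycle \<Gamma> a z x = orbit_cocycle \<Gamma> a z y + orbit_cocycle \<Gamma> a y x"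
proof -
  let ?G = "BijGroup (space M)"
  obtain g h where g: "g \<in> \<Gamma>" "y = g x" and h: "h \<in> \<Gamma>" "z = h y"
    using y z by (auto simp: group_orbit_def)
  have m: "h \<otimes>\<^bsub>?G\<^esub> g \<in> \<Gamma>"
    using borel_group_subgroup h(1) g(1) by (rule subgroup.m_closed)
  have z: "z = (h \<otimes>\<^bsub>?G\<^esub> g) x"
    using borel_group_mult_apply[OF h(1) g(1) x] g h by simp
  have "orbit_cocycle \<Gamma> a z x = a (h \<otimes>\<^bsub>?G\<^esub> g) x"
    unfolding z using m x by (rule orbit_cocycle_eq)
  also have "\<dots> = a h y + a g x"
    using a h(1) g x by (simp add: cocycle_def)
  also have "a h y = orbit_cocycle \<Gamma> a z y"
    using orbit_cocycle_eq[OF h(1) borel_group_apply_mem[OF g(1) x], of a] g h by simp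
  also have "a g x = orbit_cocycle \<Gamma> a y x"
    using orbit_cocycle_eq[OF g(1) x, of a] g by simp
  finally show ?thesis .
qed

lemma cocycle_measurable:
  assumes "cocycle M \<Gamma> a" "\<gamma> \<in> \<Gamma>"
  shows "a \<gamma> \<in> borel_measurable M"
proof -
  have "(\<lambda>x. (\<lambda>(\<gamma>, x). a \<gamma> x) (Pair \<gamma> x)) \<in> borel_measurable M"
    using assms by (intro measurable_compose[OF measurable_Pair1']) (auto simp: cocycle_def)
  then show ?thesis by simp
qed

text \<open>The group element carrying \<open>x\<close> to \<open>f x\<close> takes countably many
  values, and its fibre over \<open>\<gamma>\<close> is the set where \<open>\<gamma>\<close> and
  \<open>f\<close> agree. The measurable maps \<open>a \<gamma>\<close> are glued along these
  fibres.\<close>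

lemma borel_measurable_orbit_cocycle:
  assumes a: "cocycle M \<Gamma> a"
    and eq: "\<And>\<gamma>. \<gamma> \<in> \<Gamma> \<Longrightarrow> {x \<in> space M. \<gamma> x = f x} \<in> sets M"
    and f: "\<And>x. x \<in> space M \<Longrightarrow> f x \<in> group_orbit \<Gamma> x"
  shows "(\<lambda>x. orbit_cocycle \<Gamma> a (f x) x) \<in> borel_measurable M"
proof -
  define \<rho> where "\<rho> x = (THE \<gamma>. \<gamma> \<in> \<Gamma> \<and> \<gamma> x = f x)" for x
  have \<rho>: "\<rho> x \<in> \<Gamma>" "\<rho> x x = f x" if x: "x \<in> space M" for x
  proof -
    obtain g where g: "g \<in> \<Gamma>" "f x = g x"
      using f[OF x] by (auto simp: group_orbit_def)
    then have "\<rho> x = g"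
      using free_action_The[OF g(1) x] by (simp add: \<rho>_def)
    then show "\<rho> x \<in> \<Gamma>" "\<rho> x x = f x" using g by simp_all
  qed
  have "\<rho> \<in> measurable M (count_space \<Gamma>)"
  proof (subst measurable_count_space_eq_countable[OF borel_group_countable], intro conjI ballI)
    show "\<rho> \<in> space M \<rightarrow> \<Gamma>" using \<rho> by auto
    fix \<gamma> assume \<gamma>: "\<gamma> \<in> \<Gamma>"
    have "x \<in> \<rho> -` {\<gamma>} \<inter> space M \<longleftrightarrow> x \<in> {x \<in> space M. \<gamma> x = f x}" for x
      using \<rho>[of x] free_action_unique[OF \<rho>(1)[of x] \<gamma>, of x] by auto
    then have "\<rho> -` {\<gamma>} \<inter> space M = {x \<in> space M. \<gamma> x = f x}" by (simp only: set_eq_iff) simp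
    then show "\<rho> -` {\<gamma>} \<inter> space M \<in> sets M" using eq[OF \<gamma>] by simp
  qed
  with cocycle_measurable[OF a] have "(\<lambda>x. a (\<rho> x) x) \<in> borel_measurable M"
    using borel_group_countable by (rule measurable_compose_countable'[where f = a])
  then show ?thesis unfolding orbit_cocycle_def \<rho>_def .
qed

text \<open>The coboundary of \<open>c\<close> telescopes along products; joint measurability is
  checked for each of the countably many group elements.\<close>

lemma cocycle_twist:
  fixes a :: "('a \<Rightarrow> 'a) \<Rightarrow> 'a \<Rightarrow> 'g::{topological_ab_group_add, second_countable_topology}"
  assumes a: "cocycle M \<Gamma> a" and c: "c \<in> borel_measurable M"
  shows "cocycle M \<Gamma> (\<lambda>\<gamma> x. a \<gamma> x - (c (\<gamma> x) - c x))"
  unfolding cocycle_def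
proof (intro conjI ballI)
  have "(\<lambda>x. a \<gamma> x - (c (\<gamma> x) - c x)) \<in> borel_measurable M" if g: "\<gamma> \<in> \<Gamma>" for \<gamma>
    using measurable_compose[OF borel_group_measurable[OF g] c] c cocycle_measurable[OF a g]
    by (intro borel_measurable_diff_group)
  then show "(\<lambda>(\<gamma>, x). a \<gamma> x - (c (\<gamma> x) - c x)) \<in> borel_measurable (count_space \<Gamma> \<Otimes>\<^sub>M M)"
    by (intro measurable_pair_measure_countable1[OF borel_group_countable]) simp
next
  fix g h x assume "g \<in> \<Gamma>" "h \<in> \<Gamma>" "x \<in> space M"
  then show "a (g \<otimes>\<^bsub>BijGroup (space M)\<^esub> h) x - (c ((g \<otimes>\<^bsub>BijGroup (space M)\<^esub> h) x) - c x) =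
    a g (h x) - (c (g (h x)) - c (h x)) + (a h x - (c (h x) - c x))"
    using a by (simp add: cocycle_def borel_group_mult_apply)
next
  fix x assume "x \<in> space M"
  then show "a \<one>\<^bsub>BijGroup (space M)\<^esub> x - (c (\<one>\<^bsub>BijGroup (space M)\<^esub> x) - c x) = 0"
    using a by (simp add: cocycle_def BijGroup_one_apply)
qed

end

section \<open>Passage to the dense subgroup\<close>

lemma subgroup_add_sum:
  assumes "subgroup_add H" "\<And>i. i \<in> I \<Longrightarrow> f i \<in> H"
  shows "sum f I \<in> H"
  using assms(2)
  by (induction I rule: infinite_finite_induct) (use assms(1) in \<open>auto simp: subgroup_add_def\<close>)

lemma subgroup_add_diff: "subgroup_add H \<Longrightarrow> a \<in> H \<Longrightarrow> b \<in> H \<Longrightarrow> a - b \<in> H"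
  unfolding subgroup_add_def by (metis diff_conv_add_uminus)

text \<open>The maps \<open>\<tau> n\<close> move points within their orbits, and their kernels
  increase and exhaust the orbit relation; this is all that the argument takes from the
  odometer.\<close>

lemma hyperfinite_cocycle_cohomologous:
  fixes M :: "'a measure"
    and \<alpha> :: "('a \<Rightarrow> 'a) \<Rightarrow> 'a \<Rightarrow>
               'g::{topological_ab_group_add, second_countable_topology, t2_space}"
  assumes \<Gamma>: "countable_borel_group M \<Gamma>" "acts_freely M \<Gamma>"
    and lc: "locally_compact_space (euclidean :: 'g topology)"
    and \<alpha>: "cocycle M \<Gamma> \<alpha>"
    and H: "subgroup_add H" "countable H" "closure H = UNIV"
    and eq: "\<And>f g. f \<in> measurable M M \<Longrightarrow> g \<in> measurable M M \<Longrightarrow> {x \<in> space M. f x = g x} \<in> sets M"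
    and \<tau>: "\<And>n. \<tau> n \<in> measurable M M"
    and orb: "\<And>n x. x \<in> space M \<Longrightarrow> \<tau> n x \<in> group_orbit \<Gamma> x"
    and \<tau>0: "\<And>x. x \<in> space M \<Longrightarrow> \<tau> 0 x = x"
    and \<tau>Suc: "\<And>n x. x \<in> space M \<Longrightarrow> \<tau> (Suc n) (\<tau> n x) = \<tau> (Suc n) x"
    and ex: "\<And>x y. x \<in> space M \<Longrightarrow> y \<in> group_orbit \<Gamma> x \<Longrightarrow> \<exists>n. \<tau> n x = \<tau> n y"
  shows "\<exists>\<beta>. cocycle M \<Gamma> \<beta> \<and> (\<forall>\<gamma>\<in>\<Gamma>. \<forall>x\<in>space M. \<beta> \<gamma> x \<in> H) \<and> cohomologous M \<Gamma> \<alpha> \<beta>"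
proof -
  note sub = borel_group_subgroup[OF \<Gamma>]
  let ?A = "orbit_cocycle \<Gamma> \<alpha>"
  define E where "E i y = ?A (\<tau> (Suc i) y) y" for i y
  have \<tau>sp: "\<tau> n x \<in> space M" if "x \<in> space M" for n x
    using measurable_space[OF \<tau> that] .
  have A_sum: "?A (\<tau> n x) x = (\<Sum>i<n. E i (\<tau> i x))" if x: "x \<in> space M" for n x
  proof (induction n)
    case 0
    have "x \<in> group_orbit \<Gamma> x" using group_orbit_refl[OF sub x] .
    \<comment> \<open>Additivity along the constant path makes this value equal to its own
      double.\<close>
    then have "?A x x = 0"
      using orbit_cocycle_add[OF \<Gamma> \<alpha> x, of x x] by simp
    then show ?case by (simp add: \<tau>0 x)
  next
    case (Suc n)
    have "\<tau> (Suc n) x \<in> group_orbit \<Gamma> (\<tau> n x)"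
      using orb[OF \<tau>sp[OF x], of "Suc n" n] \<tau>Suc[OF x] by simp
    then have "?A (\<tau> (Suc n) x) x = ?A (\<tau> (Suc n) x) (\<tau> n x) + ?A (\<tau> n x) x"
      by (rule orbit_cocycle_add[OF \<Gamma> \<alpha> x orb[OF x]])
    then show ?case using Suc \<tau>Suc[OF x, of n] by (simp add: E_def add.commute)
  qed
  have E_meas: "(\<lambda>x. E i (\<tau> i x)) \<in> borel_measurable M" for i
  proof (rule measurable_compose[OF \<tau>])
    show "E i \<in> borel_measurable M"
      unfolding E_def
      by (rule borel_measurable_orbit_cocycle[OF \<Gamma> \<alpha>])
        (use eq borel_group_measurable[OF \<Gamma>] \<tau> orb in auto)
  qed

  \<comment> \<open>Local compactness supplies the compact set that confines all partial sums of the
    corrections.\<close>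
  obtain W K where W: "open W" "(0::'g) \<in> W" "W \<subseteq> K" and K: "compact K"
    using lc[unfolded locally_compact_space_def, rule_format, of 0] by auto
  obtain U where U: "summable_nbhds U" "U 0 \<subseteq> W"
    using summable_nbhds_exist[OF W(1,2)] by blast
  have "\<exists>q. q \<in> measurable borel borel \<and> (\<forall>g. q g \<in> H) \<and> (\<forall>g. q g - g \<in> U (Suc i))" for i
    using dense_borel_approximation[OF H(2,3) summable_nbhdsD(1,2)[OF U(1), of "Suc i"]] by metis
  then obtain q where q: "\<And>i. q i \<in> measurable borel borel" "\<And>i g. q i g \<in> H"
    "\<And>i g. q i g - g \<in> U (Suc i)"
    by metis
  define r where "r i x = q i (E i (\<tau> i x)) - E i (\<tau> i x)" for i x
  have rU: "r i x \<in> U (Suc i)" for i x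
    using q(3) by (simp add: r_def)
  have "\<exists>l. (\<lambda>m. \<Sum>i<m. r i x) \<longlonglongrightarrow> l" for x
    using U W(3) by (intro partial_sums_converge[OF U(1) rU K]) auto
  then obtain c where c: "\<And>x. (\<lambda>m. \<Sum>i<m. r i x) \<longlonglongrightarrow> c x"
    by metis
  have r_meas: "r i \<in> borel_measurable M" for i
    unfolding r_def using measurable_compose[OF E_meas q(1)] E_meas
    by (intro borel_measurable_diff_group)
  have c_meas: "c \<in> borel_measurable M"
    by (rule borel_measurable_sum_limit[OF U(1) r_meas rU c])

  \<comment> \<open>From \<open>n\<close> on the points have the same images under
    \<open>\<tau>\<close>, hence the same terms, so the differences of partial sums are
    constant.\<close>
  have c_diff: "c y - c x = (\<Sum>i<n. r i y) - (\<Sum>i<n. r i x)"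
    if x: "x \<in> space M" and y: "y \<in> space M" and n: "\<tau> n x = \<tau> n y" for x y n
  proof -
    have \<tau>m: "\<tau> m x = \<tau> m y" if "m \<ge> n" for m
      using that
    proof (induction m rule: dec_induct)
      case (step m)
      then show ?case using \<tau>Suc[OF x, of m] \<tau>Suc[OF y, of m] by simp
    qed (rule n)
    have const: "(\<Sum>i<m. r i y) - (\<Sum>i<m. r i x) = (\<Sum>i<n. r i y) - (\<Sum>i<n. r i x)"
      if "m \<ge> n" for m
      using that
    proof (induction m rule: dec_induct)
      case (step m)
      then show ?case using \<tau>m[of m] by (simp add: r_def)
    qed simp
    have "(\<lambda>m. (\<Sum>i<m. r i y) - (\<Sum>i<m. r i x)) \<longlonglongrightarrow> c y - c x"
      by (intro tendsto_diff c)
    moreover have "(\<lambda>m. (\<Sum>i<m. r i y) - (\<Sum>i<m. r i x)) \<longlonglongrightarrow> (\<Sum>i<n. r i y) - (\<Sum>i<n. r i x)"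
      by (intro tendsto_eventually eventually_sequentiallyI[of n] const)
    ultimately show ?thesis by (rule LIMSEQ_unique)
  qed

  define \<beta> where "\<beta> \<gamma> x = \<alpha> \<gamma> x - (c (\<gamma> x) - c x)" for \<gamma> x
  have "\<beta> \<gamma> x \<in> H" if g: "\<gamma> \<in> \<Gamma>" and x: "x \<in> space M" for \<gamma> x
  proof -
    let ?y = "\<gamma> x"
    have y: "?y \<in> space M" "?y \<in> group_orbit \<Gamma> x"
      using g x borel_group_apply_mem[OF \<Gamma>] by (auto simp: group_orbit_def)
    obtain n where n: "\<tau> n x = \<tau> n ?y" using ex[OF x y(2)] ..
    \<comment> \<open>The common point \<open>\<tau> n x\<close> is reached from \<open>x\<close>
      directly and through \<open>?y\<close>; comparison gives
      \<open>\<alpha> \<gamma> x\<close>.\<close>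
    have "?A (\<tau> n x) x = ?A (\<tau> n x) ?y + ?A ?y x"
      using orb[OF y(1), of n] n by (intro orbit_cocycle_add[OF \<Gamma> \<alpha> x y(2)]) simp
    then have "\<alpha> \<gamma> x = (\<Sum>i<n. E i (\<tau> i x)) - (\<Sum>i<n. E i (\<tau> i ?y))"
      using A_sum[OF x, of n] A_sum[OF y(1), of n] n orbit_cocycle_eq[OF \<Gamma> g x, of \<alpha>]
      by (simp add: algebra_simps)
    \<comment> \<open>The increments \<open>E\<close> in the corrections cancel those in
      \<open>\<alpha> \<gamma> x\<close>, which leaves only values of the
      \<open>q i\<close>.\<close>
    then have "\<beta> \<gamma> x = (\<Sum>i<n. q i (E i (\<tau> i x))) - (\<Sum>i<n. q i (E i (\<tau> i ?y)))"
      unfolding \<beta>_def c_diff[OF x y(1) n] by (simp add: r_def sum_subtractf)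
    also have "\<dots> \<in> H"
      using H(1) q(2) by (intro subgroup_add_diff subgroup_add_sum)
    finally show ?thesis .
  qed
  moreover have "cocycle M \<Gamma> \<beta>"
    unfolding \<beta>_def using \<Gamma> \<alpha> c_meas by (rule cocycle_twist)
  moreover have "cohomologous M \<Gamma> \<alpha> \<beta>"
    unfolding cohomologous_def using c_meas by (intro bexI[of _ c]) (auto simp: \<beta>_def)
  ultimately show ?thesis by (intro exI[of _ \<beta>] conjI ballI)
qed

theorem theorem5p3:
  fixes M :: "'a measure"
    and \<Gamma> :: "('a \<Rightarrow> 'a) set"
    and \<alpha> :: "('a \<Rightarrow> 'a) \<Rightarrow> 'a \<Rightarrow>
               'g::{topological_ab_group_add, second_countable_topology, t2_space}"
    and H :: "'g set"
  assumes "standard_borel M"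
    and "countable_borel_group M \<Gamma>"
    and "acts_freely M \<Gamma>"
    and "orbit_equivalent M \<Gamma> odometer_space odometer_group"
    and "locally_compact_space (euclidean :: 'g topology)"
    and "cocycle M \<Gamma> \<alpha>"
    and "subgroup_add H" and "countable H" and "closure H = UNIV"
  shows "\<exists>\<beta>. cocycle M \<Gamma> \<beta> \<and> (\<forall>\<gamma>\<in>\<Gamma>. \<forall>x\<in>space M. \<beta> \<gamma> x \<in> H) \<and> cohomologous M \<Gamma> \<alpha> \<beta>"
proof -
  obtain \<phi> where iso: "borel_isomorphism M odometer_space \<phi>"
    and orb: "\<And>x. x \<in> space M \<Longrightarrow> \<phi> ` group_orbit \<Gamma> x = group_orbit odometer_group (\<phi> x)"
    using assms(4) by (auto simp: orbit_equivalent_def)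
  define \<psi> where "\<psi> = inv_into (space M) \<phi>"
  have bij: "bij_betw \<phi> (space M) (space odometer_space)"
    and \<phi>: "\<phi> \<in> measurable M odometer_space" and \<psi>: "\<psi> \<in> measurable odometer_space M"
    using iso by (auto simp: borel_isomorphism_def \<psi>_def)
  have \<phi>sp: "\<phi> x \<in> space odometer_space" if "x \<in> space M" for x
    using measurable_space[OF \<phi> that] .
  have \<psi>\<phi>: "\<psi> (\<phi> x) = x" if "x \<in> space M" for x
    unfolding \<psi>_def using bij that by (rule bij_betw_inv_into_left)
  have \<phi>\<psi>: "\<phi> (\<psi> y) = y" if "y \<in> space odometer_space" for y
    unfolding \<psi>_def using bij that by (rule bij_betw_inv_into_right)
  note orbit_space = group_orbit_subset[OF borel_group_subgroup[OF assms(2,3)]]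
  have tsp: "trunc n (\<phi> x) \<in> space odometer_space" if "x \<in> space M" for n x
    using measurable_space[OF measurable_trunc \<phi>sp[OF that]] .
  show ?thesis
  proof (rule hyperfinite_cocycle_cohomologous[OF assms(2,3,5-9),
        where \<tau> = "\<lambda>n x. \<psi> (trunc n (\<phi> x))"])
    fix f g assume f: "f \<in> measurable M M" and g: "g \<in> measurable M M"
    \<comment> \<open>Injectivity of \<open>\<phi>\<close> moves the comparison to digit sequences,
      where equality is a countable condition.\<close>
    have "\<phi> (f x) = \<phi> (g x) \<longleftrightarrow> f x = g x" if "x \<in> space M" for x
      using bij_betw_imp_inj_on[OF bij] measurable_space[OF f that] measurable_space[OF g that]
      by (rule inj_on_eq_iff)
    then have "{x \<in> space M. f x = g x} = {x \<in> space M. \<phi> (f x) = \<phi> (g x)}"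
      by (simp cong: conj_cong)
    also have "\<dots> \<in> sets M"
      using f g by (intro sets_Collect_eq_odometer_space measurable_compose[OF _ \<phi>])
    finally show "{x \<in> space M. f x = g x} \<in> sets M" .
  next
    fix n
    show "(\<lambda>x. \<psi> (trunc n (\<phi> x))) \<in> measurable M M"
      by (rule measurable_compose[OF measurable_compose[OF \<phi> measurable_trunc] \<psi>])
  next
    fix n x assume x: "x \<in> space M"
    \<comment> \<open>Truncation stays in the odometer orbit, which orbit equivalence identifies
      with the image of the orbit of \<open>x\<close>.\<close>
    have "trunc n (\<phi> x) \<in> \<phi> ` group_orbit \<Gamma> x"
      using trunc_mem_orbit[OF \<phi>sp[OF x]] orb[OF x] by simp
    then obtain y where y: "y \<in> group_orbit \<Gamma> x" "trunc n (\<phi> x) = \<phi> y" by blast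
    then show "\<psi> (trunc n (\<phi> x)) \<in> group_orbit \<Gamma> x"
      using \<psi>\<phi>[OF orbit_space[OF x y(1)]] by simp
    show "\<psi> (trunc 0 (\<phi> x)) = x"
      using x by (simp add: trunc_0 \<psi>\<phi>)
    show "\<psi> (trunc (Suc n) (\<phi> (\<psi> (trunc n (\<phi> x))))) = \<psi> (trunc (Suc n) (\<phi> x))"
      by (simp add: \<phi>\<psi>[OF tsp[OF x]] trunc_Suc_trunc)
  next
    fix x y assume x: "x \<in> space M" and y: "y \<in> group_orbit \<Gamma> x"
    then have "\<phi> y \<in> group_orbit odometer_group (\<phi> x)"
      using orb[OF x] by blast
    then obtain n where "trunc n (\<phi> x) = trunc n (\<phi> y)"
      using orbit_imp_trunc_eq[OF \<phi>sp[OF x]] by metis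
    then show "\<exists>n. \<psi> (trunc n (\<phi> x)) = \<psi> (trunc n (\<phi> y))"
      by (intro exI[of _ n]) simp
  qed
qed

end
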